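(* Consider the online multiple knapsack problem with departures (defined in the context), and suppose that for every resource $k\in K$ the demand bound satisfies $\epsilon_k \le \frac{C_k\ln 2}{\gamma_k}$, where $\gamma_k = 2\ln(2+4\bar\theta_k\bar d_k)$. Then Algorithm 1 outputs a feasible (integral) solution, and it has a competitive ratio of $O\big(\log(\bar\theta^{\max}\cdot \bar d^{\max})\big)$, where $\bar\theta^{\max}=\max_{k\in K}\bar\theta_k$ and $\bar d^{\max}=\max_{k\in K}\bar d_k$.
   Context: Problem (online multiple knapsack with departures). There is a finite set $K$ of resources, resource $k$ having capacity $C_k>0$, a discrete time horizon $T$ of time slots, and a set $N$ of requests that arrive one at a time. For each request $n$ and resource $k$ there are a reward $v_{nk}\ge 0$, a demand (weight) $w_{nk}>0$, a start slot $s_{nk}$ and an integer duration $d_{nk}\ge 1$; let $T_{nk}=\{s_{nk},s_{nk}+1,\dots,s_{nk}+d_{nk}-1\}\subseteq T$. When request $n$ arrives, all the data $(v_{nk},w_{nk},s_{nk},d_{nk})_{k\in K}$ are revealed, and the online algorithm must immediately and irrevocably either reject $n$ or assign it to exactly one resource, without knowledge of future requests. A solution $x\in\{0,1\}^{N\times K}$ is feasible if $\sum_{k}x_{nk}\le 1$ for all $n$ and $\sum_{n\in N:\,t\in T_{nk}} w_{nk}x_{nk}\le C_k$ for all $k\in K$, $t\in T$; its value is $\sum_{n,k}v_{nk}x_{nk}$. Assumptions: (A1) the value density $\theta_{nk}=\frac{v_{nk}}{w_{nk}d_{nk}}$ of every request with $v_{nk}>0$ lies in $[\theta_k^{\min},\theta_k^{\max}]$,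 where $0<\theta_k^{\min}\le\theta_k^{\max}<\infty$ and $\theta_k^{\min}$ and $\bar\theta_k=\theta_k^{\max}/\theta_k^{\min}$ are known to the algorithm; (A2) $d_{nk}\in[d_k^{\min},d_k^{\max}]$ with $\bar d_k=d_k^{\max}/d_k^{\min}$ finite and known; (A3) $w_{nk}\le \epsilon_k\le C_k$ for all $n\in N$, $k\in K$. Parameters: $\gamma_k=2\ln(2+4\bar\theta_k\bar d_k)$, $\mu_{nk}=e^{w_{nk}\gamma_k/C_k}$, $\beta_{nk}=\theta_k^{\min}(\mu_{nk}-1)$. Algorithm 1: initialize $x=0$, prices $p_{kt}=0$ ($k\in K,t\in T$), and $u_n=0$ ($n\in N$). When request $n$ arrives, let $k^*\in\arg\max_{k\in K}\{v_{nk}-w_{nk}\sum_{t\in T_{nk}}p_{kt}\}$. If $v_{nk^*}>w_{nk^*}\sum_{t\in T_{nk^*}}p_{k^*t}$, set $x_{nk^*}=1$, $u_n=v_{nk^*}-w_{nk^*}\sum_{t\in T_{nk^*}}p_{k^*t}$, and for every $t\in T_{nk^*}$ update $p_{k^*t}\leftarrow \mu_{nk^*}p_{k^*t}+\beta_{nk^*}$; otherwise reject $n$ and change nothing. Competitive ratio: the algorithm has competitive ratio $\alpha$ if for every instance satisfying the assumptions, the optimal offline value (maximum value of a feasible integral solution knowing all requests in advance) is at most $\alpha$ times the value of the algorithm's solution. *)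

theory Defs
  imports Complex_Main "HOL-Library.Landau_Symbols"
begin

text \<open>
  Requests are numbered \<open>0, 1, \<dots>, num_requests - 1\<close> in their order of arrival. The last five
  fields are the bounds appearing in the assumptions.
\<close>

record 'k omkd =
  resources :: "'k set"
  capacity :: "'k \<Rightarrow> real"
  slots :: "nat set"
  num_requests :: nat
  reward :: "nat \<Rightarrow> 'k \<Rightarrow> real"
  demand :: "nat \<Rightarrow> 'k \<Rightarrow> real"
  start :: "nat \<Rightarrow> 'k \<Rightarrow> nat"
  duration :: "nat \<Rightarrow> 'k \<Rightarrow> nat"
  theta_min :: "'k \<Rightarrow> real"
  theta_max :: "'k \<Rightarrow> real"
  d_min :: "'k \<Rightarrow> real"
  d_max :: "'k \<Rightarrow> real"
  eps :: "'k \<Rightarrow> real"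

definition requests :: "'k omkd \<Rightarrow> nat set" where
  "requests I = {..<num_requests I}"

definition active :: "'k omkd \<Rightarrow> nat \<Rightarrow> 'k \<Rightarrow> nat set" where
  "active I n k = {start I n k..<start I n k + duration I n k}"

definition density :: "'k omkd \<Rightarrow> nat \<Rightarrow> 'k \<Rightarrow> real" where
  "density I n k = reward I n k / (demand I n k * real (duration I n k))"

definition theta_bar :: "'k omkd \<Rightarrow> 'k \<Rightarrow> real" where
  "theta_bar I k = theta_max I k / theta_min I k"

definition d_bar :: "'k omkd \<Rightarrow> 'k \<Rightarrow> real" where
  "d_bar I k = d_max I k / d_min I k"

definition theta_bar_max :: "'k omkd \<Rightarrow> real" where
  "theta_bar_max I = Max (theta_bar I ` resources I)"

definition d_bar_max :: "'k omkd \<Rightarrow> real" where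
  "d_bar_max I = Max (d_bar I ` resources I)"

definition well_formed :: "'k omkd \<Rightarrow> bool" where
  "well_formed I \<longleftrightarrow>
     finite (resources I) \<and> resources I \<noteq> {} \<and> finite (slots I) \<and>
     (\<forall>k\<in>resources I. 0 < capacity I k) \<and>
     (\<forall>n\<in>requests I. \<forall>k\<in>resources I.
        0 \<le> reward I n k \<and> 0 < demand I n k \<and> 1 \<le> duration I n k \<and> active I n k \<subseteq> slots I)"

definition density_assumption :: "'k omkd \<Rightarrow> bool" where
  "density_assumption I \<longleftrightarrow>
     (\<forall>k\<in>resources I. 0 < theta_min I k \<and> theta_min I k \<le> theta_max I k) \<and>
     (\<forall>n\<in>requests I. \<forall>k\<in>resources I.
        0 < reward I n k \<longrightarrow> density I n k \<in> {theta_min I k..theta_max I k})"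

definition duration_assumption :: "'k omkd \<Rightarrow> bool" where
  "duration_assumption I \<longleftrightarrow>
     (\<forall>k\<in>resources I. 0 < d_min I k \<and> d_min I k \<le> d_max I k) \<and>
     (\<forall>n\<in>requests I. \<forall>k\<in>resources I. real (duration I n k) \<in> {d_min I k..d_max I k})"

definition demand_assumption :: "'k omkd \<Rightarrow> bool" where
  "demand_assumption I \<longleftrightarrow>
     (\<forall>k\<in>resources I. eps I k \<le> capacity I k) \<and>
     (\<forall>n\<in>requests I. \<forall>k\<in>resources I. demand I n k \<le> eps I k)"

definition admissible :: "'k omkd \<Rightarrow> bool" where
  "admissible I \<longleftrightarrow>
     well_formed I \<and> density_assumption I \<and> duration_assumption I \<and> demand_assumption I"

definition feasible :: "'k omkd \<Rightarrow> (nat \<Rightarrow> 'k \<Rightarrow> real) \<Rightarrow> bool" where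
  "feasible I x \<longleftrightarrow>
     (\<forall>n\<in>requests I. \<forall>k\<in>resources I. x n k \<in> {0, 1}) \<and>
     (\<forall>n\<in>requests I. (\<Sum>k\<in>resources I. x n k) \<le> 1) \<and>
     (\<forall>k\<in>resources I. \<forall>t\<in>slots I.
        (\<Sum>n | n \<in> requests I \<and> t \<in> active I n k. demand I n k * x n k) \<le> capacity I k)"

definition sol_value :: "'k omkd \<Rightarrow> (nat \<Rightarrow> 'k \<Rightarrow> real) \<Rightarrow> real" where
  "sol_value I x = (\<Sum>n\<in>requests I. \<Sum>k\<in>resources I. reward I n k * x n k)"

definition opt_value :: "'k omkd \<Rightarrow> real" where
  "opt_value I = Max (sol_value I ` {x. feasible I x})"

definition gamma :: "'k omkd \<Rightarrow> 'k \<Rightarrow> real" where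
  "gamma I k = 2 * ln (2 + 4 * theta_bar I k * d_bar I k)"

definition mu :: "'k omkd \<Rightarrow> nat \<Rightarrow> 'k \<Rightarrow> real" where
  "mu I n k = exp (demand I n k * gamma I k / capacity I k)"

definition beta :: "'k omkd \<Rightarrow> nat \<Rightarrow> 'k \<Rightarrow> real" where
  "beta I n k = theta_min I k * (mu I n k - 1)"

record 'k alg_state =
  sol :: "nat \<Rightarrow> 'k \<Rightarrow> real"
  price :: "'k \<Rightarrow> nat \<Rightarrow> real"
  util :: "nat \<Rightarrow> real"

definition init_state :: "'k alg_state" where
  "init_state = \<lparr>sol = (\<lambda>n k. 0), price = (\<lambda>k t. 0), util = (\<lambda>n. 0)\<rparr>"

definition cost :: "'k omkd \<Rightarrow> 'k alg_state \<Rightarrow> nat \<Rightarrow> 'k \<Rightarrow> real" where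
  "cost I s n k = demand I n k * (\<Sum>t\<in>active I n k. price s k t)"

definition best_resource :: "'k omkd \<Rightarrow> 'k alg_state \<Rightarrow> nat \<Rightarrow> 'k \<Rightarrow> bool" where
  "best_resource I s n k \<longleftrightarrow>
     is_arg_max (\<lambda>j. reward I n j - cost I s n j) (\<lambda>j. j \<in> resources I) k"

definition assign :: "'k omkd \<Rightarrow> nat \<Rightarrow> 'k \<Rightarrow> 'k alg_state \<Rightarrow> 'k alg_state" where
  "assign I n k s =
     \<lparr>sol = (sol s)(n := (sol s n)(k := 1)),
      price = (price s)(k := (\<lambda>t. if t \<in> active I n k
                                  then mu I n k * price s k t + beta I n k
                                  else price s k t)),
      util = (util s)(n := reward I n k - cost I s n k)\<rparr>"

text \<open>
  The algorithm leaves open how ties in the arg max are broken, so a run is a relation: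
  \<open>alg_run I n s\<close> says that \<open>s\<close> is a possible state after the first \<open>n\<close> requests.
\<close>

inductive alg_step :: "'k omkd \<Rightarrow> nat \<Rightarrow> 'k alg_state \<Rightarrow> 'k alg_state \<Rightarrow> bool" for I n s where
  accept: "best_resource I s n k \<Longrightarrow> reward I n k > cost I s n k \<Longrightarrow>
             alg_step I n s (assign I n k s)"
| reject: "best_resource I s n k \<Longrightarrow> \<not> reward I n k > cost I s n k \<Longrightarrow>
             alg_step I n s s"

inductive alg_run :: "'k omkd \<Rightarrow> nat \<Rightarrow> 'k alg_state \<Rightarrow> bool" for I where
  init: "alg_run I 0 init_state"
| step: "alg_run I n s \<Longrightarrow> alg_step I n s s' \<Longrightarrow> alg_run I (Suc n) s'"

definition alg_output :: "'k omkd \<Rightarrow> (nat \<Rightarrow> 'k \<Rightarrow> real) \<Rightarrow> bool" where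
  "alg_output I x \<longleftrightarrow> (\<exists>s. alg_run I (num_requests I) s \<and> x = sol s)"

text \<open>
  The ratio \<open>\<alpha>\<close> may depend on the parameters of the instance; \<open>P\<close> is the class of instances considered.
\<close>

definition has_competitive_ratio :: "('k omkd \<Rightarrow> bool) \<Rightarrow> ('k omkd \<Rightarrow> real) \<Rightarrow> bool" where
  "has_competitive_ratio P \<alpha> \<longleftrightarrow>
     (\<forall>I x. P I \<longrightarrow> alg_output I x \<longrightarrow> opt_value I \<le> \<alpha> I * sol_value I x)"

definition small_demands :: "'k omkd \<Rightarrow> bool" where
  "small_demands I \<longleftrightarrow> (\<forall>k\<in>resources I. eps I k \<le> capacity I k * ln 2 / gamma I k)"

lemma best_resource_exists:
  assumes "well_formed I"
  shows "\<exists>k. best_resource I s n k"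
proof -
  let ?f = "\<lambda>j. reward I n j - cost I s n j"
  have fin: "finite (?f ` resources I)" and ne: "?f ` resources I \<noteq> {}"
    using assms by (auto simp: well_formed_def)
  obtain k where k: "k \<in> resources I" "?f k = Max (?f ` resources I)"
    using Max_in[OF fin ne] by (metis (no_types, lifting) imageE)
  have "?f j \<le> ?f k" if "j \<in> resources I" for j
    using Max_ge[OF fin, of "?f j"] that k(2) by auto
  then have "best_resource I s n k"
    using k(1) by (auto simp: best_resource_def is_arg_max_def not_less)
  then show ?thesis ..
qed

lemma alg_output_exists:
  assumes "well_formed I"
  shows "\<exists>x. alg_output I x"
proof -
  have "\<exists>s. alg_run I n s" for n
  proof (induction n)
    case 0
    show ?case by (blast intro: alg_run.init)
  next
    case (Suc n)
    then obtain s where s: "alg_run I n s" ..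
    obtain k where "best_resource I s n k"
      using best_resource_exists[OF assms] by blast
    then have "\<exists>s'. alg_step I n s s'"
      by (blast intro: alg_step.intros)
    with s show ?case by (blast intro: alg_run.step)
  qed
  then show ?thesis by (auto simp: alg_output_def)
qed

lemma feasible_zero:
  assumes "well_formed I"
  shows "feasible I (\<lambda>n k. 0)"
  using assms by (auto simp: feasible_def well_formed_def less_imp_le)

lemma finite_feasible_values:
  assumes "well_formed I"
  shows "finite (sol_value I ` {x. feasible I x})"
proof -
  let ?R = "requests I \<times> resources I"
  let ?g = "\<lambda>A. \<Sum>(n, k)\<in>?R. reward I n k * (if (n, k) \<in> A then 1 else 0)"
  have "finite ?R"
    using assms by (simp add: well_formed_def requests_def)
  moreover have "sol_value I ` {x. feasible I x} \<subseteq> ?g ` Pow ?R"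
  proof
    fix v assume "v \<in> sol_value I ` {x. feasible I x}"
    then obtain x where x: "feasible I x" and v: "v = sol_value I x" by auto
    have "v = (\<Sum>(n, k)\<in>?R. reward I n k * x n k)"
      by (simp add: v sol_value_def sum.cartesian_product)
    also have "\<dots> = ?g {(n, k) \<in> ?R. x n k = 1}"
      using x by (intro sum.cong) (force simp: feasible_def)+
    finally show "v \<in> ?g ` Pow ?R" by blast
  qed
  ultimately show ?thesis by (meson finite_Pow_iff finite_imageI finite_subset)
qed

end

theory Submission
  imports Defs "HOL-Real_Asymp.Real_Asymp"
begin

text \<open>
  Prices are an exponential function of the load: a slot of resource \<open>k\<close> with load \<open>L\<close> has price
  \<open>theta_min * (exp (gamma * L / capacity) - 1)\<close>.

  Feasibility: every request active at a slot \<open>t\<close> has length at least \<open>d_min\<close>, so it covers the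
  \<open>h = \<lceil>d_min / 2\<rceil>\<close> slots ending at \<open>t\<close> or the \<open>h\<close> slots starting at \<open>t\<close>. Hence it is enough that
  the accepted requests covering a fixed window of \<open>h\<close> slots never exceed half the capacity. If a
  request would violate this, then before its arrival all \<open>h\<close> slots have load above
  \<open>capacity / 2 - eps\<close> and so, by the choice of \<open>gamma\<close>, price at least \<open>2 * theta_max * d_bar\<close>. Its
  cost is then at least \<open>demand * theta_max * d_max\<close>, which is no less than its reward, and it is
  rejected.

  Competitiveness: the final prices together with the utilities are feasible for the dual linear
  program, and accepting a request of reward \<open>v\<close> on \<open>k\<close> raises the dual objective by at most
  \<open>(1 + 4 * gamma) * v\<close>.
\<close>

lemma exp_minus_one_le_double:
  assumes "0 \<le> (y::real)" "y \<le> 1"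
  shows "exp y - 1 \<le> 2 * y"
proof -
  have "y\<^sup>2 \<le> y"
    using assms by (simp add: power2_eq_square mult_left_le)
  with exp_bound[OF assms] show ?thesis by linarith
qed

lemma half_windows_of_long_intervals:
  fixes t h :: nat
  shows "\<exists>L R. card L = h \<and> card R = h \<and>
    (\<forall>a d. t \<in> {a..<a + d} \<longrightarrow> 2 * h \<le> d + 1 \<longrightarrow> L \<subseteq> {a..<a + d} \<or> R \<subseteq> {a..<a + d})"
proof (cases "h \<le> t + 1")
  case True
  then show ?thesis
    by (intro exI[of _ "{t + 1 - h..<t + 1}"] exI[of _ "{t..<t + h}"]) auto
next
  case False
  \<comment> \<open>Fewer than \<open>h\<close> slots precede \<open>t + 1\<close>, so only the window starting at \<open>t\<close> can occur.\<close>
  then show ?thesis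
    by (intro exI[of _ "{t..<t + h}"]) auto
qed

section \<open>Loads and prices\<close>

lemma finite_requests [simp]: "finite (requests I)"
  by (simp add: requests_def)

lemma finite_active [simp]: "finite (active I n k)"
  by (simp add: active_def)

lemma card_active [simp]: "card (active I n k) = duration I n k"
  by (simp add: active_def)

text \<open>
  The capacity constraint at \<open>t\<close> concerns the window \<open>W = {t}\<close>; larger windows single out the
  requests that occupy all of \<open>W\<close>.
\<close>

definition load :: "'k omkd \<Rightarrow> (nat \<Rightarrow> 'k \<Rightarrow> real) \<Rightarrow> 'k \<Rightarrow> nat set \<Rightarrow> real" where
  "load I x k W = (\<Sum>n | n \<in> requests I \<and> W \<subseteq> active I n k. demand I n k * x n k)"

definition load_price :: "'k omkd \<Rightarrow> 'k \<Rightarrow> real \<Rightarrow> real" where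
  "load_price I k l = theta_min I k * (exp (gamma I k * l / capacity I k) - 1)"

lemma load_price_add_demand:
  "load_price I k (l + demand I n k) = mu I n k * load_price I k l + beta I n k"
proof -
  have "exp (gamma I k * (l + demand I n k) / capacity I k) =
      mu I n k * exp (gamma I k * l / capacity I k)"
    by (simp add: mu_def exp_add[symmetric] add_divide_distrib algebra_simps)
  then show ?thesis
    by (simp add: load_price_def beta_def algebra_simps)
qed

section \<open>Runs of the algorithm\<close>

lemma sol_assign:
    "sol (assign I n k s) m j = (if m = n \<and> j = k then 1 else sol s m j)"
  and price_assign:
    "price (assign I n k s) j t =
       (if j = k \<and> t \<in> active I n k then mu I n k * price s j t + beta I n k else price s j t)"
  and util_assign:
    "util (assign I n k s) m = (if m = n then reward I n k - cost I s n k else util s m)"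
  by (simp_all add: assign_def)

lemma best_resource_iff:
  "best_resource I s n k \<longleftrightarrow> k \<in> resources I \<and>
     (\<forall>j\<in>resources I. reward I n j - cost I s n j \<le> reward I n k - cost I s n k)"
  by (auto simp: best_resource_def is_arg_max_def not_less)

lemma alg_run_induct [consumes 1, case_names init accept reject]:
  assumes "alg_run I n s"
    and "P 0 init_state"
    and "\<And>n s k. \<lbrakk>alg_run I n s; P n s; best_resource I s n k; cost I s n k < reward I n k\<rbrakk>
           \<Longrightarrow> P (Suc n) (assign I n k s)"
    and "\<And>n s k. \<lbrakk>alg_run I n s; P n s; best_resource I s n k; reward I n k \<le> cost I s n k\<rbrakk>
           \<Longrightarrow> P (Suc n) s"
  shows "P n s"
  using assms(1)
proof (induction rule: alg_run.induct)
  case init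
  show ?case by (fact assms(2))
next
  case (step n s s')
  from step.hyps(2) show ?case
  proof cases
    case (accept k)
    with assms(3)[OF step.hyps(1) step.IH] show ?thesis by simp
  next
    case (reject k)
    with assms(4)[OF step.hyps(1) step.IH] show ?thesis by simp
  qed
qed

lemma run_sol_zero:
  assumes "alg_run I n s" "n \<le> m"
  shows "sol s m k = 0"
  using assms by (induction rule: alg_run_induct) (auto simp: init_state_def sol_assign)

lemma run_sol_binary:
  assumes "alg_run I n s"
  shows "sol s m k \<in> {0, 1}"
  using assms by (induction rule: alg_run_induct) (auto simp: init_state_def sol_assign)

lemma run_sol_nonneg:
  assumes "alg_run I n s"
  shows "0 \<le> sol s m k"
  using run_sol_binary[OF assms, of m k] by auto

lemma run_sol_sum_le_1:
  assumes "alg_run I n s" "finite (resources I)"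
  shows "(\<Sum>k\<in>resources I. sol s m k) \<le> 1"
  using assms(1)
proof (induction rule: alg_run_induct)
  case init
  show ?case by (simp add: init_state_def)
next
  case (accept n s k)
  show ?case
  proof (cases "m = n")
    case True
    have "sol (assign I n k s) n j = (if j = k then 1 else 0)" for j
      using run_sol_zero[OF accept.hyps(1), of n j] by (simp add: sol_assign)
    then show ?thesis
      using True assms(2) by simp
  next
    case False
    then show ?thesis using accept.IH by (simp add: sol_assign)
  qed
qed

lemma run_util_zero:
  assumes "alg_run I n s" "n \<le> m"
  shows "util s m = 0"
  using assms by (induction rule: alg_run_induct) (auto simp: init_state_def util_assign)

lemma run_util_nonneg:
  assumes "alg_run I n s"
  shows "0 \<le> util s m"
  using assms by (induction rule: alg_run_induct) (auto simp: init_state_def util_assign)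

lemma load_assign:
  assumes "n \<in> requests I" "sol s n k = 0"
  shows "load I (sol (assign I n k s)) j W =
    load I (sol s) j W + (if j = k \<and> W \<subseteq> active I n k then demand I n k else 0)"
proof -
  have "demand I m j * sol (assign I n k s) m j = demand I m j * sol s m j +
      (if m = n then if j = k then demand I n k else 0 else 0)" for m
    using assms(2) by (simp add: sol_assign)
  then show ?thesis
    using assms(1) by (simp add: load_def sum.distrib)
qed

lemma run_price:
  assumes "alg_run I n s" "n \<le> num_requests I"
  shows "price s k t = load_price I k (load I (sol s) k {t})"
  using assms
proof (induction arbitrary: k t rule: alg_run_induct)
  case init
  show ?case by (simp add: init_state_def load_price_def load_def)
next
  case (accept n s j)
  then show ?case
    using run_sol_zero[OF accept.hyps(1), of n j]
    by (simp add: load_assign price_assign requests_def load_price_add_demand)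
qed simp

section \<open>Linear programming duality\<close>

definition dual_value :: "'k omkd \<Rightarrow> ('k \<Rightarrow> nat \<Rightarrow> real) \<Rightarrow> (nat \<Rightarrow> real) \<Rightarrow> real" where
  "dual_value I p u =
     (\<Sum>k\<in>resources I. \<Sum>t\<in>slots I. capacity I k * p k t) + (\<Sum>n\<in>requests I. u n)"

definition dual_feasible :: "'k omkd \<Rightarrow> ('k \<Rightarrow> nat \<Rightarrow> real) \<Rightarrow> (nat \<Rightarrow> real) \<Rightarrow> bool" where
  "dual_feasible I p u \<longleftrightarrow>
     (\<forall>k\<in>resources I. \<forall>t\<in>slots I. 0 \<le> p k t) \<and> (\<forall>n\<in>requests I. 0 \<le> u n) \<and>
     (\<forall>n\<in>requests I. \<forall>k\<in>resources I.
        reward I n k \<le> u n + demand I n k * (\<Sum>t\<in>active I n k. p k t))"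

locale well_formed_instance =
  fixes I :: "'k omkd"
  assumes well_formed: "well_formed I"
begin

lemma finite_resources: "finite (resources I)"
  and finite_slots: "finite (slots I)"
  using well_formed by (auto simp: well_formed_def)

lemma capacity_pos: "k \<in> resources I \<Longrightarrow> 0 < capacity I k"
  using well_formed by (auto simp: well_formed_def)

context
  fixes n k
  assumes n: "n \<in> requests I" and k: "k \<in> resources I"
begin

lemma reward_nonneg: "0 \<le> reward I n k"
  and demand_pos: "0 < demand I n k"
  and duration_pos: "0 < duration I n k"
  and active_subset_slots: "active I n k \<subseteq> slots I"
  using well_formed n k by (auto simp: well_formed_def Suc_le_eq)

end

lemma sum_demand_price_eq_sum_load:
  assumes k: "k \<in> resources I"
  shows "(\<Sum>n\<in>requests I. demand I n k * (\<Sum>t\<in>active I n k. p t) * x n k) =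
    (\<Sum>t\<in>slots I. load I x k {t} * p t)"
proof -
  have "active I n k = {t. t \<in> slots I \<and> t \<in> active I n k}" if "n \<in> requests I" for n
    using active_subset_slots[OF that k] by auto
  then have "(\<Sum>n\<in>requests I. demand I n k * (\<Sum>t\<in>active I n k. p t) * x n k) =
      (\<Sum>n\<in>requests I. \<Sum>t | t \<in> slots I \<and> t \<in> active I n k. demand I n k * x n k * p t)"
    by (intro sum.cong refl) (simp add: sum_distrib_left sum_distrib_right ac_simps)
  also have "\<dots> = (\<Sum>t\<in>slots I. \<Sum>n | n \<in> requests I \<and> t \<in> active I n k. demand I n k * x n k * p t)"
    using finite_slots by (intro sum.swap_restrict) auto
  also have "\<dots> = (\<Sum>t\<in>slots I. load I x k {t} * p t)"
    by (simp add: load_def sum_distrib_right)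
  finally show ?thesis .
qed

theorem weak_duality:
  assumes dual: "dual_feasible I p u" and x: "feasible I x"
  shows "sol_value I x \<le> dual_value I p u"
proof -
  have x_nonneg: "0 \<le> x n k" if "n \<in> requests I" "k \<in> resources I" for n k
  proof -
    have "x n k \<in> {0, 1}"
      using x that unfolding feasible_def by blast
    then show ?thesis by auto
  qed
  let ?c = "\<lambda>n k. demand I n k * (\<Sum>t\<in>active I n k. p k t)"
  have "sol_value I x \<le> (\<Sum>n\<in>requests I. \<Sum>k\<in>resources I. (u n + ?c n k) * x n k)"
    unfolding sol_value_def
    using dual x_nonneg by (intro sum_mono mult_right_mono) (auto simp: dual_feasible_def)
  also have "\<dots> = (\<Sum>n\<in>requests I. u n * (\<Sum>k\<in>resources I. x n k)) +
      (\<Sum>k\<in>resources I. \<Sum>n\<in>requests I. ?c n k * x n k)"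
    by (subst (2) sum.swap) (simp add: distrib_right sum.distrib sum_distrib_left)
  also have "(\<Sum>n\<in>requests I. u n * (\<Sum>k\<in>resources I. x n k)) \<le> (\<Sum>n\<in>requests I. u n)"
    using dual x by (intro sum_mono mult_left_le) (auto simp: feasible_def dual_feasible_def)
  also have "(\<Sum>k\<in>resources I. \<Sum>n\<in>requests I. ?c n k * x n k) =
      (\<Sum>k\<in>resources I. \<Sum>t\<in>slots I. load I x k {t} * p k t)"
    by (intro sum.cong refl sum_demand_price_eq_sum_load)
  also have "\<dots> \<le> (\<Sum>k\<in>resources I. \<Sum>t\<in>slots I. capacity I k * p k t)"
    using dual x
    by (intro sum_mono mult_right_mono) (auto simp: load_def feasible_def dual_feasible_def)
  finally show ?thesis by (simp add: dual_value_def)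
qed

corollary opt_value_le_dual_value:
  assumes "dual_feasible I p u"
  shows "opt_value I \<le> dual_value I p u"
  unfolding opt_value_def
  using finite_feasible_values[OF well_formed] feasible_zero[OF well_formed] weak_duality[OF assms]
  by (subst Max_le_iff) auto

section \<open>Load estimates and the effect of an acceptance\<close>

lemma load_nonneg:
  assumes "k \<in> resources I" "\<And>n. 0 \<le> x n k"
  shows "0 \<le> load I x k W"
  unfolding load_def
  using assms demand_pos by (intro sum_nonneg mult_nonneg_nonneg) (auto intro: less_imp_le)

lemma load_le_add_of_cover:
  assumes k: "k \<in> resources I" and x: "\<And>n. 0 \<le> x n k"
    and cover: "\<And>n. n \<in> requests I \<Longrightarrow> W \<subseteq> active I n k \<Longrightarrow>
      L \<subseteq> active I n k \<or> R \<subseteq> active I n k"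
  shows "load I x k W \<le> load I x k L + load I x k R"
proof -
  let ?N = "\<lambda>V. {n. n \<in> requests I \<and> V \<subseteq> active I n k}" and ?f = "\<lambda>n. demand I n k * x n k"
  have nonneg: "0 \<le> ?f n" if "n \<in> requests I" for n
    using demand_pos[OF that k] x[of n] by simp
  have "sum ?f (?N W) \<le> sum ?f (?N L \<union> ?N R)"
    using cover nonneg by (intro sum_mono2) auto
  also have "\<dots> \<le> sum ?f (?N L \<union> ?N R) + sum ?f (?N L \<inter> ?N R)"
    using nonneg by (auto intro: sum_nonneg)
  also have "\<dots> = sum ?f (?N L) + sum ?f (?N R)"
    by (intro sum.union_inter) auto
  finally show ?thesis
    by (simp add: load_def)
qed

lemma load_antimono:
  assumes k: "k \<in> resources I" and x: "\<And>n. 0 \<le> x n k" and "V \<subseteq> W"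
  shows "load I x k W \<le> load I x k V"
  unfolding load_def
proof (rule sum_mono2)
  show "0 \<le> demand I n k * x n k"
    if "n \<in> {n. n \<in> requests I \<and> V \<subseteq> active I n k} - {n. n \<in> requests I \<and> W \<subseteq> active I n k}" for n
    using that demand_pos[of n k] k x[of n] by simp
qed (use \<open>V \<subseteq> W\<close> in auto)

lemma sol_value_assign:
  assumes "n \<in> requests I" "k \<in> resources I" "sol s n k = 0"
  shows "sol_value I (sol (assign I n k s)) = sol_value I (sol s) + reward I n k"
proof -
  have "reward I m j * sol (assign I n k s) m j = reward I m j * sol s m j +
      (if j = k then if m = n then reward I n k else 0 else 0)" for m j
    using assms(3) by (simp add: sol_assign)
  then show ?thesis
    using assms(1,2) finite_resources
    by (simp add: sol_value_def sum.distrib)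
qed

lemma sum_price_assign:
  assumes n: "n \<in> requests I" and k: "k \<in> resources I"
  shows "(\<Sum>j\<in>resources I. \<Sum>t\<in>slots I. capacity I j * price (assign I n k s) j t) =
    (\<Sum>j\<in>resources I. \<Sum>t\<in>slots I. capacity I j * price s j t) +
    capacity I k * (mu I n k - 1) * (\<Sum>t\<in>active I n k. price s k t + theta_min I k)"
proof -
  let ?inc = "\<lambda>t. capacity I k * (mu I n k - 1) * (price s k t + theta_min I k)"
  have "capacity I j * price (assign I n k s) j t = capacity I j * price s j t +
      (if j = k then if t \<in> active I n k then ?inc t else 0 else 0)" for j t
    by (simp add: price_assign beta_def algebra_simps)
  moreover have "slots I \<inter> active I n k = active I n k"
    using active_subset_slots[OF n k] by auto
  then have "(\<Sum>t\<in>slots I. if t \<in> active I n k then ?inc t else 0) = sum ?inc (active I n k)"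
    using finite_slots by (simp flip: sum.inter_restrict)
  then have "(\<Sum>t\<in>slots I. if j = k then if t \<in> active I n k then ?inc t else 0 else 0) =
      (if j = k then sum ?inc (active I n k) else 0)" for j
    by simp
  ultimately show ?thesis
    using k finite_resources
    by (simp add: sum.distrib sum_distrib_left[symmetric])
qed

lemma dual_value_assign:
  assumes "n \<in> requests I" "k \<in> resources I" "util s n = 0"
  shows "dual_value I (price (assign I n k s)) (util (assign I n k s)) =
    dual_value I (price s) (util s) + (reward I n k - cost I s n k) +
    capacity I k * (mu I n k - 1) * (\<Sum>t\<in>active I n k. price s k t + theta_min I k)"
proof -
  have "util (assign I n k s) m =
      util s m + (if m = n then reward I n k - cost I s n k else 0)" for m
    using assms(3) by (simp add: util_assign)
  then have "(\<Sum>m\<in>requests I. util (assign I n k s) m) =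
      (\<Sum>m\<in>requests I. util s m) + (reward I n k - cost I s n k)"
    using assms(1) by (simp add: sum.distrib)
  then show ?thesis
    unfolding dual_value_def sum_price_assign[OF assms(1,2)] by simp
qed

end

section \<open>Bounded densities and durations\<close>

locale bounded_instance = well_formed_instance +
  assumes density_assumption: "density_assumption I"
    and duration_assumption: "duration_assumption I"
begin

context
  fixes k
  assumes k: "k \<in> resources I"
begin

lemma theta_min_pos: "0 < theta_min I k"
  and theta_min_le_theta_max: "theta_min I k \<le> theta_max I k"
  using density_assumption k by (auto simp: density_assumption_def)

lemma d_min_pos: "0 < d_min I k"
  and d_min_le_d_max: "d_min I k \<le> d_max I k"
  using duration_assumption k by (auto simp: duration_assumption_def)

lemma theta_bar_ge_1: "1 \<le> theta_bar I k"
  using theta_min_pos theta_min_le_theta_max by (simp add: theta_bar_def)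

lemma d_bar_ge_1: "1 \<le> d_bar I k"
  using d_min_pos d_min_le_d_max by (simp add: d_bar_def)

lemma theta_bar_mult_d_bar_pos: "0 < theta_bar I k * d_bar I k"
  using theta_bar_ge_1 d_bar_ge_1 by (intro mult_pos_pos) auto

lemma gamma_pos: "0 < gamma I k"
  using theta_bar_mult_d_bar_pos by (simp add: gamma_def mult.assoc)

lemma exp_half_gamma: "exp (gamma I k / 2) = 2 + 4 * theta_bar I k * d_bar I k"
  using theta_bar_mult_d_bar_pos by (simp add: gamma_def mult.assoc)

lemma gamma_le_max: "gamma I k \<le> 2 * ln (2 + 4 * (theta_bar_max I * d_bar_max I))"
proof -
  have "theta_bar I k \<le> theta_bar_max I" "d_bar I k \<le> d_bar_max I"
    using k finite_resources by (auto simp: theta_bar_max_def d_bar_max_def)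
  then have "theta_bar I k * d_bar I k \<le> theta_bar_max I * d_bar_max I"
    using theta_bar_ge_1 d_bar_ge_1 by (intro mult_mono) auto
  then show ?thesis
    using theta_bar_mult_d_bar_pos by (simp add: gamma_def mult.assoc)
qed

lemma load_price_mono: "l \<le> l' \<Longrightarrow> load_price I k l \<le> load_price I k l'"
  using theta_min_pos gamma_pos capacity_pos[OF k]
  by (simp add: load_price_def divide_right_mono)

lemma load_price_nonneg: "0 \<le> l \<Longrightarrow> 0 \<le> load_price I k l"
  using load_price_mono[of 0 l] by (simp add: load_price_def)

end

context
  fixes n k
  assumes n: "n \<in> requests I" and k: "k \<in> resources I"
begin

lemma d_min_le_duration: "d_min I k \<le> real (duration I n k)"
  and duration_le_d_max: "real (duration I n k) \<le> d_max I k"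
  using duration_assumption n k by (auto simp: duration_assumption_def)

lemma mu_ge_1: "1 \<le> mu I n k"
  using demand_pos[OF n k] gamma_pos[OF k] capacity_pos[OF k] by (simp add: mu_def)

lemma beta_nonneg: "0 \<le> beta I n k"
  using mu_ge_1 theta_min_pos[OF k] by (simp add: beta_def)

lemma reward_ge:
  assumes "0 < reward I n k"
  shows "theta_min I k * (demand I n k * real (duration I n k)) \<le> reward I n k"
proof -
  have "theta_min I k \<le> density I n k"
    using density_assumption n k assms by (auto simp: density_assumption_def)
  then show ?thesis
    using demand_pos[OF n k] duration_pos[OF n k] by (simp add: density_def pos_le_divide_eq)
qed

lemma reward_le: "reward I n k \<le> demand I n k * (theta_max I k * d_max I k)"
proof (cases "0 < reward I n k")
  case True
  then have "density I n k \<le> theta_max I k"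
    using density_assumption n k by (auto simp: density_assumption_def)
  then have "reward I n k \<le> demand I n k * (theta_max I k * real (duration I n k))"
    using demand_pos[OF n k] duration_pos[OF n k]
    by (simp add: density_def pos_divide_le_eq ac_simps)
  also have "\<dots> \<le> demand I n k * (theta_max I k * d_max I k)"
    using demand_pos[OF n k] duration_le_d_max theta_min_pos[OF k] theta_min_le_theta_max[OF k]
    by (intro mult_left_mono) auto
  finally show ?thesis .
next
  case False
  moreover have "0 < theta_max I k * d_max I k"
    using theta_min_pos[OF k] theta_min_le_theta_max[OF k] d_min_pos[OF k] d_min_le_d_max[OF k]
    by (intro mult_pos_pos) auto
  then have "0 < demand I n k * (theta_max I k * d_max I k)"
    using demand_pos[OF n k] by simp
  ultimately show ?thesis by linarith
qed

lemma price_le_price_assign: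
  assumes "0 \<le> price s j t"
  shows "price s j t \<le> price (assign I n k s) j t"
proof -
  have "1 * price s j t \<le> mu I n k * price s j t"
    using mu_ge_1 assms by (rule mult_right_mono)
  then show ?thesis
    using beta_nonneg by (auto simp: price_assign)
qed

lemma cost_nonneg:
  assumes "\<And>t. 0 \<le> price s k t"
  shows "0 \<le> cost I s n k"
  using assms demand_pos[OF n k] by (simp add: cost_def sum_nonneg)

lemma reward_le_cost_of_expensive_window:
  assumes nonneg: "\<And>t. 0 \<le> price s k t"
    and W: "W \<subseteq> active I n k" "d_min I k \<le> 2 * real (card W)"
    and expensive: "\<And>t. t \<in> W \<Longrightarrow> 2 * theta_max I k * d_bar I k \<le> price s k t"
  shows "reward I n k \<le> cost I s n k"
proof -
  have "0 \<le> theta_max I k * d_bar I k"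
    using theta_min_pos[OF k] theta_min_le_theta_max[OF k] d_bar_ge_1[OF k] by simp
  then have "d_min I k * (theta_max I k * d_bar I k) \<le>
      2 * real (card W) * (theta_max I k * d_bar I k)"
    using W(2) by (intro mult_right_mono)
  then have "theta_max I k * d_max I k \<le> (\<Sum>t\<in>W. 2 * theta_max I k * d_bar I k)"
    using d_min_pos[OF k] by (simp add: d_bar_def ac_simps)
  also have "\<dots> \<le> (\<Sum>t\<in>W. price s k t)"
    by (intro sum_mono expensive)
  also have "\<dots> \<le> (\<Sum>t\<in>active I n k. price s k t)"
    using W(1) nonneg by (intro sum_mono2) auto
  finally have "demand I n k * (theta_max I k * d_max I k) \<le> cost I s n k"
    using demand_pos[OF n k] by (simp add: cost_def)
  then show ?thesis
    using reward_le by linarith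
qed

end

lemma run_price_nonneg:
  assumes "alg_run I n s" "n \<le> num_requests I" "k \<in> resources I"
  shows "0 \<le> price s k t"
  using assms by (simp add: run_price load_price_nonneg load_nonneg run_sol_nonneg)

lemma run_dual_constraint:
  assumes run: "alg_run I n s" "n \<le> num_requests I" "m < n" and k: "k \<in> resources I"
  shows "reward I m k \<le> util s m + cost I s m k"
  using run
proof (induction rule: alg_run_induct)
  case (accept n s j)
  then have n: "n \<in> requests I" and m: "m \<in> requests I" and j: "j \<in> resources I"
    by (auto simp: requests_def best_resource_iff)
  have "price s k t \<le> price (assign I n j s) k t" for t
    using run_price_nonneg[OF accept.hyps(1) Suc_leD[OF accept.prems(1)] k]
    by (rule price_le_price_assign[OF n j])
  then have "cost I s m k \<le> cost I (assign I n j s) m k"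
    unfolding cost_def using demand_pos[OF m k]
    by (intro mult_left_mono sum_mono) auto
  moreover have "reward I m k \<le> util (assign I n j s) m + cost I s m k"
    using accept k by (cases "m = n") (auto simp: util_assign best_resource_iff algebra_simps)
  ultimately show ?case by linarith
next
  case (reject n s j)
  then show ?case
    using run_util_zero[OF reject.hyps(1), of n] k
    by (cases "m = n") (force simp: best_resource_iff)+
qed simp

lemma run_dual_feasible:
  assumes "alg_run I (num_requests I) s"
  shows "dual_feasible I (price s) (util s)"
  using run_price_nonneg[OF assms] run_util_nonneg[OF assms] run_dual_constraint[OF assms]
  by (simp add: dual_feasible_def cost_def requests_def)

end

section \<open>Small demands\<close>

locale small_demand_instance = bounded_instance +
  assumes demand_assumption: "demand_assumption I"
    and small_demands: "small_demands I"
begin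

context
  fixes n k
  assumes n: "n \<in> requests I" and k: "k \<in> resources I"
begin

lemma demand_gamma_le_ln_2: "demand I n k * gamma I k / capacity I k \<le> ln 2"
proof -
  have "demand I n k \<le> eps I k"
    using demand_assumption n k by (auto simp: demand_assumption_def)
  also have "\<dots> \<le> capacity I k * ln 2 / gamma I k"
    using small_demands k by (auto simp: small_demands_def)
  finally show ?thesis
    using gamma_pos[OF k] capacity_pos[OF k] by (simp add: field_simps)
qed

lemma capacity_mu_minus_one_le: "capacity I k * (mu I n k - 1) \<le> 2 * gamma I k * demand I n k"
proof -
  let ?y = "demand I n k * gamma I k / capacity I k"
  have "?y \<le> 1"
    using demand_gamma_le_ln_2 ln_le_minus_one[of "2::real"] by linarith
  then have "mu I n k - 1 \<le> 2 * ?y"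
    unfolding mu_def using demand_pos[OF n k] gamma_pos[OF k] capacity_pos[OF k]
    by (intro exp_minus_one_le_double) auto
  then show ?thesis
    using capacity_pos[OF k] by (simp add: field_simps)
qed

lemma load_price_half_capacity_ge:
  "2 * theta_max I k * d_bar I k \<le> load_price I k (capacity I k / 2 - demand I n k)"
proof -
  have "gamma I k * (capacity I k / 2 - demand I n k) / capacity I k =
      gamma I k / 2 - demand I n k * gamma I k / capacity I k"
    using capacity_pos[OF k] by (simp add: field_simps)
  then have "gamma I k / 2 - ln 2 \<le> gamma I k * (capacity I k / 2 - demand I n k) / capacity I k"
    using demand_gamma_le_ln_2 by linarith
  then have "exp (gamma I k / 2 - ln 2) \<le>
      exp (gamma I k * (capacity I k / 2 - demand I n k) / capacity I k)"
    by simp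
  moreover have "exp (gamma I k / 2 - ln 2) = 1 + 2 * theta_bar I k * d_bar I k"
    using exp_half_gamma[OF k] by (simp add: exp_diff)
  ultimately have "theta_min I k * (2 * theta_bar I k * d_bar I k) \<le>
      load_price I k (capacity I k / 2 - demand I n k)"
    using theta_min_pos[OF k] by (simp add: load_price_def)
  then show ?thesis
    using theta_min_pos[OF k] by (simp add: theta_bar_def)
qed

end

lemma accepted_load_le_half_capacity:
  assumes run: "alg_run I n s" and n: "n \<in> requests I" and k: "k \<in> resources I"
    and accepted: "cost I s n k < reward I n k"
    and W: "W \<subseteq> active I n k" "d_min I k \<le> 2 * real (card W)"
  shows "load I (sol s) k W + demand I n k \<le> capacity I k / 2"
proof (rule ccontr)
  assume "\<not> ?thesis"
  then have overload: "capacity I k / 2 - demand I n k < load I (sol s) k W"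
    by simp
  have n_le: "n \<le> num_requests I"
    using n by (simp add: requests_def)
  have "2 * theta_max I k * d_bar I k \<le> price s k t" if "t \<in> W" for t
  proof -
    have "load I (sol s) k W \<le> load I (sol s) k {t}"
      using that run_sol_nonneg[OF run] by (intro load_antimono[OF k]) auto
    then have "load_price I k (capacity I k / 2 - demand I n k) \<le> price s k t"
      unfolding run_price[OF run n_le] using overload by (intro load_price_mono[OF k]) linarith
    then show ?thesis
      using load_price_half_capacity_ge[OF n k] by linarith
  qed
  then have "reward I n k \<le> cost I s n k"
    by (rule reward_le_cost_of_expensive_window[OF n k run_price_nonneg[OF run n_le k] W])
  with accepted show False by simp
qed

lemma run_load_le_half_capacity:
  assumes run: "alg_run I n s" "n \<le> num_requests I" and k: "k \<in> resources I"
    and W: "d_min I k \<le> 2 * real (card W)"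
  shows "load I (sol s) k W \<le> capacity I k / 2"
  using run
proof (induction rule: alg_run_induct)
  case init
  show ?case using capacity_pos[OF k] by (simp add: load_def init_state_def)
next
  case (accept n s j)
  then have n: "n \<in> requests I" by (simp add: requests_def)
  show ?case
    unfolding load_assign[OF n run_sol_zero[OF accept.hyps(1) order_refl]]
    using accept accepted_load_le_half_capacity[OF accept.hyps(1) n k _ _ W] by auto
qed simp

lemma run_load_le_capacity:
  assumes run: "alg_run I n s" and n: "n \<le> num_requests I" and k: "k \<in> resources I"
  shows "load I (sol s) k {t} \<le> capacity I k"
proof -
  define h where "h = nat \<lceil>d_min I k / 2\<rceil>"
  have h: "d_min I k \<le> 2 * real h" "2 * real h < d_min I k + 2"
    using d_min_pos[OF k] by (auto simp: h_def) linarith+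
  obtain L R where card: "card L = h" "card R = h"
    and window: "t \<in> {a..<a + d} \<Longrightarrow> 2 * h \<le> d + 1 \<Longrightarrow> L \<subseteq> {a..<a + d} \<or> R \<subseteq> {a..<a + d}"
    for a d
    using half_windows_of_long_intervals[of h t] by blast
  have "load I (sol s) k {t} \<le> load I (sol s) k L + load I (sol s) k R"
  proof (rule load_le_add_of_cover[OF k run_sol_nonneg[OF run]])
    fix m assume m: "m \<in> requests I" "{t} \<subseteq> active I m k"
    have "2 * h \<le> duration I m k + 1"
      using d_min_le_duration[OF m(1) k] h(2) by linarith
    with m(2) window show "L \<subseteq> active I m k \<or> R \<subseteq> active I m k"
      by (simp add: active_def)
  qed
  also have "\<dots> \<le> capacity I k / 2 + capacity I k / 2"
    using h(1) card by (intro add_mono run_load_le_half_capacity[OF run n k]) auto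
  finally show ?thesis by simp
qed

theorem run_feasible:
  assumes "alg_run I (num_requests I) s"
  shows "feasible I (sol s)"
  using run_sol_binary[OF assms] run_sol_sum_le_1[OF assms finite_resources]
    run_load_le_capacity[OF assms order_refl]
  by (auto simp: feasible_def load_def)

lemma price_increase_le:
  assumes n: "n \<in> requests I" and k: "k \<in> resources I"
    and price: "\<And>t. 0 \<le> price s k t" and accepted: "cost I s n k < reward I n k"
  shows "capacity I k * (mu I n k - 1) * (\<Sum>t\<in>active I n k. price s k t + theta_min I k)
    \<le> 4 * gamma I k * reward I n k"
proof -
  let ?S = "\<Sum>t\<in>active I n k. price s k t + theta_min I k"
  have "0 < reward I n k"
    using cost_nonneg[OF n k price] accepted by linarith
  then have "theta_min I k * (demand I n k * real (duration I n k)) \<le> reward I n k"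
    by (rule reward_ge[OF n k])
  moreover have "demand I n k * ?S =
      cost I s n k + theta_min I k * (demand I n k * real (duration I n k))"
    by (simp add: cost_def sum.distrib algebra_simps)
  ultimately have "demand I n k * ?S \<le> 2 * reward I n k"
    using accepted by linarith
  have "capacity I k * (mu I n k - 1) * ?S \<le> 2 * gamma I k * demand I n k * ?S"
    using capacity_mu_minus_one_le[OF n k] price theta_min_pos[OF k]
    by (intro mult_right_mono sum_nonneg add_nonneg_nonneg) auto
  also have "\<dots> \<le> 2 * gamma I k * (2 * reward I n k)"
    using \<open>demand I n k * ?S \<le> 2 * reward I n k\<close> gamma_pos[OF k] by (simp add: mult.assoc)
  finally show ?thesis by simp
qed

lemma run_dual_le_primal:
  assumes G: "\<And>k. k \<in> resources I \<Longrightarrow> gamma I k \<le> G"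
    and run: "alg_run I n s" "n \<le> num_requests I"
  shows "dual_value I (price s) (util s) \<le> (1 + 4 * G) * sol_value I (sol s)"
  using run
proof (induction rule: alg_run_induct)
  case init
  show ?case by (simp add: dual_value_def sol_value_def init_state_def)
next
  case (accept n s k)
  then have n: "n \<in> requests I" and k: "k \<in> resources I"
    by (auto simp: requests_def best_resource_iff)
  note price_nonneg = run_price_nonneg[OF accept.hyps(1) Suc_leD[OF accept.prems] k]
  have "dual_value I (price (assign I n k s)) (util (assign I n k s))
      \<le> dual_value I (price s) (util s) + reward I n k + 4 * gamma I k * reward I n k"
    using dual_value_assign[OF n k run_util_zero[OF accept.hyps(1) order_refl]]
      price_increase_le[OF n k price_nonneg accept.hyps(3)] cost_nonneg[OF n k price_nonneg]
    by linarith
  also have "\<dots> \<le> (1 + 4 * G) * sol_value I (sol s) + reward I n k + 4 * G * reward I n k"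
    using accept.IH accept.prems G[OF k] reward_nonneg[OF n k]
    by (intro add_mono mult_right_mono) auto
  also have "\<dots> = (1 + 4 * G) * sol_value I (sol (assign I n k s))"
    using sol_value_assign[OF n k run_sol_zero[OF accept.hyps(1) order_refl]]
    by (simp add: algebra_simps)
  finally show ?case .
qed simp

theorem run_competitive:
  assumes run: "alg_run I (num_requests I) s"
  shows "opt_value I \<le> (1 + 8 * ln (2 + 4 * (theta_bar_max I * d_bar_max I))) * sol_value I (sol s)"
  using opt_value_le_dual_value[OF run_dual_feasible[OF run]]
    run_dual_le_primal[OF gamma_le_max run order_refl] by simp

end

lemma small_demand_instanceI:
  assumes "admissible I" "small_demands I"
  shows "small_demand_instance I"
  using assms by unfold_locales (auto simp: admissible_def)

theorem theorem1:
  shows "(\<forall>(I :: 'k omkd) x. admissible I \<and> small_demands I \<longrightarrow> alg_output I x \<longrightarrow> feasible I x) \<and>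
         (\<exists>\<alpha> :: real \<Rightarrow> real. \<alpha> \<in> O[at_top](\<lambda>r. ln r) \<and>
            has_competitive_ratio (\<lambda>I :: 'k omkd. admissible I \<and> small_demands I)
              (\<lambda>I. \<alpha> (theta_bar_max I * d_bar_max I)))"
proof (intro conjI exI[of _ "\<lambda>r. 1 + 8 * ln (2 + 4 * r)"])
  show "\<forall>(I :: 'k omkd) x. admissible I \<and> small_demands I \<longrightarrow> alg_output I x \<longrightarrow> feasible I x"
    by (auto simp: alg_output_def
        intro: small_demand_instance.run_feasible small_demand_instanceI)
  show "(\<lambda>r::real. 1 + 8 * ln (2 + 4 * r)) \<in> O[at_top](\<lambda>r. ln r)"
    by real_asymp
  show "has_competitive_ratio (\<lambda>I :: 'k omkd. admissible I \<and> small_demands I)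
      (\<lambda>I. 1 + 8 * ln (2 + 4 * (theta_bar_max I * d_bar_max I)))"
    by (auto simp: has_competitive_ratio_def alg_output_def
        intro!: small_demand_instance.run_competitive small_demand_instanceI)
qed

end
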